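(* Suppose each $f_i$, $i\in\{0,\dots,m\}$, is continuously differentiable with $L_i$-Lipschitz continuous gradient on $\mathbb{R}^n$, $L_i>0$. Let $x^k\in\mathbb{R}^n$ be strictly feasible, i.e. $f_i(x^k)<0$ for all $i\in\{1,\dots,m\}$. Let $\widehat{\nabla f}_i(x^k)$, $i\in\{0,\dots,m\}$, be gradient estimates with $\|\nabla f_i(x^k)-\widehat{\nabla f}_i(x^k)\|\le\epsilon_i$, and let $u(x^k)$ be the optimizer of the robust subproblem $$\min_{u\in\mathbb{R}^n}\ \tfrac12\|u\|^2+\widehat{\nabla f}_0(x^k)^\top u+\epsilon_0\|u\|\quad\text{s.t.}\quad \widehat{\nabla f}_i(x^k)^\top u+\epsilon_i\|u\|+\alpha f_i(x^k)+w_i\|u\|^2\le 0,\quad i\in\{1,\dots,m\}.$$ Define $$t_{\min}=\beta\,\min\Big\{\frac{2(1-\gamma_1)}{L_0},\ \min_{1\le i\le m}\frac{2w_i}{L_i},\ \frac{\gamma_2}{\alpha},\ t_{\mathrm{init}}\Big\}.$$ Then for all $t\in[0,t_{\min}]$ both of the following conditions hold: $$f_0(x^k+t\,u(x^k))\le f_0(x^k)-\gamma_1 t\|u(x^k)\|^2,$$ $$f_i(x^k+t\,u(x^k))\le(1-\gamma_2)f_i(x^k)\quad\text{for all } i\in\{1,\dots,m\}.$$ Consequently, the safeguarded backtracking line search (started at $t_{\mathrm{init}}$ with reduction factor $\beta$) returns a step size $t^k\ge t_{\min}$.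
   Context: $\|\cdot\|$ is the Euclidean norm. The underlying problem is $f^\star=\min_x\{f_0(x)\ :\ f_i(x)\le 0,\ i\in\{1,\dots,m\}\}$, $f_0,\dots,f_m:\mathbb{R}^n\to\mathbb{R}$, with $f^\star>-\infty$ attained at some feasible point. The constants satisfy $\epsilon_0,\dots,\epsilon_m>0$, $\alpha>0$, $w_1,\dots,w_m>0$, $\beta,\gamma_1,\gamma_2\in(0,1)$, $t_{\mathrm{init}}>0$. Standing assumption (MFCQ): for every feasible $x$ there is $d\in\mathbb{R}^n$ with $\nabla f_i(x)^\top d<0$ for all $i\in\{1,\dots,m\}$ with $f_i(x)=0$. Safeguarded backtracking line search at $x^k$: start with $t=t_{\mathrm{init}}$; while at least one of the two displayed conditions (the objective-decrease condition or the constraint condition for some $i$) fails at $t$, replace $t$ by $\beta t$; return the resulting value as $t^k$. That is, $t^k=\beta^j t_{\mathrm{init}}$ for the smallest integer $j\ge 0$ for which both conditions hold. *)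

theory Defs
  imports "HOL-Analysis.Analysis" "HOL-Library.While_Combinator"
begin

text \<open>
  A problem is given by functions \<open>f 0, \<dots>, f m\<close>: \<open>f 0\<close> is the objective and
  \<open>f 1, \<dots>, f m\<close> are the constraint functions. Values at indices above \<open>m\<close> are irrelevant,
  and \<open>m = 0\<close> (no constraints) is allowed.
\<close>

definition feasible :: "nat \<Rightarrow> (nat \<Rightarrow> real ^ 'n \<Rightarrow> real) \<Rightarrow> real ^ 'n \<Rightarrow> bool" where
  "feasible m f x \<longleftrightarrow> (\<forall>i\<in>{1..m}. f i x \<le> 0)"

definition strictly_feasible :: "nat \<Rightarrow> (nat \<Rightarrow> real ^ 'n \<Rightarrow> real) \<Rightarrow> real ^ 'n \<Rightarrow> bool" where
  "strictly_feasible m f x \<longleftrightarrow> (\<forall>i\<in>{1..m}. f i x < 0)"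

text \<open>Mangasarian--Fromovitz constraint qualification; \<open>grad i\<close> is the gradient of \<open>f i\<close>.\<close>

definition mfcq ::
  "nat \<Rightarrow> (nat \<Rightarrow> real ^ 'n \<Rightarrow> real) \<Rightarrow> (nat \<Rightarrow> real ^ 'n \<Rightarrow> real ^ 'n) \<Rightarrow> bool" where
  "mfcq m f grad \<longleftrightarrow>
     (\<forall>x. feasible m f x \<longrightarrow> (\<exists>d. \<forall>i\<in>{1..m}. f i x = 0 \<longrightarrow> grad i x \<bullet> d < 0))"

text \<open>The robust subproblem at \<open>x\<close>, with gradient estimates \<open>ghat i\<close> of \<open>f i\<close> at \<open>x\<close>.\<close>

definition robust_objective ::
  "(nat \<Rightarrow> real) \<Rightarrow> (nat \<Rightarrow> real ^ 'n) \<Rightarrow> real ^ 'n \<Rightarrow> real" where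
  "robust_objective \<epsilon> ghat u = 1/2 * (norm u)\<^sup>2 + ghat 0 \<bullet> u + \<epsilon> 0 * norm u"

definition robust_feasible ::
  "nat \<Rightarrow> (nat \<Rightarrow> real ^ 'n \<Rightarrow> real) \<Rightarrow> (nat \<Rightarrow> real) \<Rightarrow> real \<Rightarrow> (nat \<Rightarrow> real) \<Rightarrow>
   (nat \<Rightarrow> real ^ 'n) \<Rightarrow> real ^ 'n \<Rightarrow> real ^ 'n \<Rightarrow> bool" where
  "robust_feasible m f \<epsilon> \<alpha> w ghat x u \<longleftrightarrow>
     (\<forall>i\<in>{1..m}. ghat i \<bullet> u + \<epsilon> i * norm u + \<alpha> * f i x + w i * (norm u)\<^sup>2 \<le> 0)"

definition robust_optimizer ::
  "nat \<Rightarrow> (nat \<Rightarrow> real ^ 'n \<Rightarrow> real) \<Rightarrow> (nat \<Rightarrow> real) \<Rightarrow> real \<Rightarrow> (nat \<Rightarrow> real) \<Rightarrow>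
   (nat \<Rightarrow> real ^ 'n) \<Rightarrow> real ^ 'n \<Rightarrow> real ^ 'n \<Rightarrow> bool" where
  "robust_optimizer m f \<epsilon> \<alpha> w ghat x u \<longleftrightarrow>
     is_arg_min (robust_objective \<epsilon> ghat) (robust_feasible m f \<epsilon> \<alpha> w ghat x) u"

definition objective_decrease ::
  "(nat \<Rightarrow> real ^ 'n \<Rightarrow> real) \<Rightarrow> real \<Rightarrow> real ^ 'n \<Rightarrow> real ^ 'n \<Rightarrow> real \<Rightarrow> bool" where
  "objective_decrease f \<gamma>1 x u t \<longleftrightarrow> f 0 (x + t *\<^sub>R u) \<le> f 0 x - \<gamma>1 * t * (norm u)\<^sup>2"

definition constraint_condition ::
  "nat \<Rightarrow> (nat \<Rightarrow> real ^ 'n \<Rightarrow> real) \<Rightarrow> real \<Rightarrow> real ^ 'n \<Rightarrow> real ^ 'n \<Rightarrow> real \<Rightarrow> bool" where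
  "constraint_condition m f \<gamma>2 x u t \<longleftrightarrow>
     (\<forall>i\<in>{1..m}. f i (x + t *\<^sub>R u) \<le> (1 - \<gamma>2) * f i x)"

text \<open>
  The safeguarded backtracking loop. The result is \<open>None\<close> if the loop does not terminate;
  otherwise it is \<open>Some (\<beta> ^ j * tinit)\<close> for the least \<open>j\<close> at which both conditions hold.
\<close>

definition line_search ::
  "nat \<Rightarrow> (nat \<Rightarrow> real ^ 'n \<Rightarrow> real) \<Rightarrow> real \<Rightarrow> real \<Rightarrow> real \<Rightarrow> real \<Rightarrow>
   real ^ 'n \<Rightarrow> real ^ 'n \<Rightarrow> real option" where
  "line_search m f \<beta> \<gamma>1 \<gamma>2 tinit x u =
     while_option
       (\<lambda>t. \<not> (objective_decrease f \<gamma>1 x u t \<and> constraint_condition m f \<gamma>2 x u t))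
       (\<lambda>t. \<beta> * t) tinit"

text \<open>For \<open>m = 0\<close> the minimum over the constraint indices is dropped.\<close>

definition t_min ::
  "nat \<Rightarrow> (nat \<Rightarrow> real) \<Rightarrow> real \<Rightarrow> (nat \<Rightarrow> real) \<Rightarrow> real \<Rightarrow> real \<Rightarrow> real \<Rightarrow> real \<Rightarrow> real" where
  "t_min m L \<alpha> w \<beta> \<gamma>1 \<gamma>2 tinit =
     \<beta> * Min ({2 * (1 - \<gamma>1) / L 0} \<union> (\<lambda>i. 2 * w i / L i) ` {1..m} \<union> {\<gamma>2 / \<alpha>, tinit})"

end

theory Submission
  imports Defs
begin

text \<open>
  Comparing the optimizer \<open>u\<close> with \<open>s u\<close> for \<open>s \<rightarrow> 1\<close>, which is robustly feasible since
  \<open>0\<close> is, gives \<open>\<nabla>f\<^sub>0(x) \<bullet> u \<le> - \<parallel>u\<parallel>\<^sup>2\<close> without any multipliers.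
  Both conditions then follow from the descent lemma. They even hold up to \<open>t_min / \<beta>\<close>,
  so any step rejected by the line search exceeds \<open>t_min / \<beta>\<close>, and its reduction exceeds \<open>t_min\<close>.
\<close>

text \<open>The gap \<open>h\<close> between \<open>f\<close> along the ray and its quadratic upper
  model is nonincreasing on s \<ge> 0: Cauchy-Schwarz and the Lipschitz bound make its derivative
  nonpositive.\<close>

lemma descent_lemma:
  fixes f :: "'a::real_inner \<Rightarrow> real"
  assumes grad: "\<And>x. GDERIV f x :> g x"
    and lip: "L-lipschitz_on UNIV g"
    and t: "0 \<le> t"
  shows "f (x + t *\<^sub>R u) \<le> f x + t * (g x \<bullet> u) + L / 2 * t\<^sup>2 * (norm u)\<^sup>2"
proof -
  define h where "h s = f (x + s *\<^sub>R u) - s * (g x \<bullet> u) - L / 2 * s\<^sup>2 * (norm u)\<^sup>2" for s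
  have f_line: "((\<lambda>s. f (x + s *\<^sub>R u)) has_real_derivative u \<bullet> g (x + s *\<^sub>R u)) (at s)" for s
  proof -
    have "((\<lambda>s. x + s *\<^sub>R u) has_derivative (\<lambda>k. k *\<^sub>R u)) (at s)"
      by (auto intro!: derivative_eq_intros)
    from has_derivative_compose[OF this grad[unfolded gderiv_def]]
    show ?thesis
      by (simp add: has_field_derivative_def mult_commute_abs)
  qed
  have deriv: "(h has_real_derivative
      u \<bullet> g (x + s *\<^sub>R u) - g x \<bullet> u - L * s * (norm u)\<^sup>2) (at s)" for s
    unfolding h_def by (rule derivative_eq_intros f_line refl | simp)+
  have nonpos: "u \<bullet> g (x + s *\<^sub>R u) - g x \<bullet> u - L * s * (norm u)\<^sup>2 \<le> 0" if "0 \<le> s" for s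
  proof -
    have "u \<bullet> g (x + s *\<^sub>R u) - g x \<bullet> u = (g (x + s *\<^sub>R u) - g x) \<bullet> u"
      by (simp add: inner_diff_left inner_diff_right inner_commute)
    also have "\<dots> \<le> norm (g (x + s *\<^sub>R u) - g x) * norm u"
      by (rule norm_cauchy_schwarz)
    also have "\<dots> \<le> (L * (s * norm u)) * norm u"
      using lipschitz_onD[OF lip, of "x + s *\<^sub>R u" x] that
      by (intro mult_right_mono) (auto simp: dist_norm)
    finally show ?thesis by (simp add: power2_eq_square)
  qed
  have "h t \<le> h 0"
    using t deriv nonpos by (intro DERIV_nonpos_imp_nonincreasing[of 0 t h]) blast+
  then show ?thesis by (simp add: h_def)
qed

text \<open>Cauchy-Schwarz applied to the estimation error \<open>g - ghat\<close>. The margin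
  \<open>\<epsilon> * norm u\<close> thus turns bounds on estimated slopes into bounds on true
  slopes.\<close>

lemma inner_le_robust_inner:
  fixes g ghat u :: "'a::real_inner"
  assumes "norm (g - ghat) \<le> \<epsilon>"
  shows "g \<bullet> u \<le> ghat \<bullet> u + \<epsilon> * norm u"
proof -
  have "(g - ghat) \<bullet> u \<le> norm (g - ghat) * norm u" by (rule norm_cauchy_schwarz)
  also have "\<dots> \<le> \<epsilon> * norm u" using assms by (simp add: mult_right_mono)
  finally show ?thesis by (simp add: inner_diff_left)
qed

text \<open>The robustly feasible set is star-shaped about 0: the first two terms scale by s, the
  quadratic one by s^2 \<le> s, and the constant \<open>\<alpha> * f i x\<close> is nonpositive,
  hence at most s times itself.\<close>

lemma robust_feasible_scaleR:
  assumes u: "robust_feasible m f \<epsilon> \<alpha> w ghat x u"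
    and x: "feasible m f x" and \<alpha>: "0 \<le> \<alpha>" and w: "\<And>i. i \<in> {1..m} \<Longrightarrow> 0 \<le> w i"
    and s: "0 \<le> s" "s \<le> 1"
  shows "robust_feasible m f \<epsilon> \<alpha> w ghat x (s *\<^sub>R u)"
  unfolding robust_feasible_def
proof
  fix i assume i: "i \<in> {1..m}"
  define a where "a = ghat i \<bullet> u + \<epsilon> i * norm u"
  have "a + \<alpha> * f i x + w i * (norm u)\<^sup>2 \<le> 0"
    using u i by (simp add: robust_feasible_def a_def)
  then have 1: "s * (a + \<alpha> * f i x + w i * (norm u)\<^sup>2) \<le> 0"
    using s by (simp add: mult_nonneg_nonpos)
  have 2: "(1 - s) * (\<alpha> * f i x) \<le> 0"
    using x i \<alpha> s by (intro mult_nonneg_nonpos) (auto simp: feasible_def)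
  have 3: "(s * (1 - s)) * (w i * (norm u)\<^sup>2) \<ge> 0"
    using w[OF i] s by simp
  \<comment> \<open>Splits the constraint at \<open>s *\<^sub>R u\<close> into s times the
    constraint at \<open>u\<close> and two corrections of known sign.\<close>
  have "s * a + \<alpha> * f i x + w i * (s\<^sup>2 * (norm u)\<^sup>2) =
      s * (a + \<alpha> * f i x + w i * (norm u)\<^sup>2) + (1 - s) * (\<alpha> * f i x)
      - (s * (1 - s)) * (w i * (norm u)\<^sup>2)"
    by (simp add: algebra_simps power2_eq_square)
  also have "\<dots> \<le> 0" using 1 2 3 by linarith
  finally show "ghat i \<bullet> (s *\<^sub>R u) + \<epsilon> i * norm (s *\<^sub>R u) + \<alpha> * f i x
      + w i * (norm (s *\<^sub>R u))\<^sup>2 \<le> 0"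
    using s by (simp add: a_def algebra_simps power_mult_distrib)
qed

text \<open>Passing from \<open>u\<close> to \<open>(1 - e) *\<^sub>R u\<close> changes the
  objective by - e * (N + c) + e^2 * N / 2. If N + c were positive, a small e would improve on the
  optimizer.\<close>

lemma robust_optimizer_descent_direction:
  assumes u: "robust_optimizer m f \<epsilon> \<alpha> w ghat x u"
    and x: "feasible m f x" and \<alpha>: "0 \<le> \<alpha>" and w: "\<And>i. i \<in> {1..m} \<Longrightarrow> 0 \<le> w i"
  shows "ghat 0 \<bullet> u + \<epsilon> 0 * norm u \<le> - (norm u)\<^sup>2"
proof (rule ccontr)
  define c where "c = ghat 0 \<bullet> u + \<epsilon> 0 * norm u"
  define N where "N = (norm u)\<^sup>2"
  assume "\<not> ?thesis"
  then have pos: "0 < N + c" by (simp add: c_def N_def)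
  have N: "0 < N"
    using pos by (cases "u = 0") (auto simp: c_def N_def)
  \<comment> \<open>The second entry ensures e * N \<le> N + c, so the quadratic increase is at most
    half of the linear decrease; the cap 1 keeps 1 - e in [0, 1].\<close>
  define e where "e = min 1 ((N + c) / N)"
  have e: "0 < e" "e \<le> 1" "e * N \<le> N + c"
    using pos N by (auto simp: e_def min_def field_simps)
  have "robust_feasible m f \<epsilon> \<alpha> w ghat x ((1 - e) *\<^sub>R u)"
    using u e by (intro robust_feasible_scaleR x \<alpha> w)
      (auto simp: robust_optimizer_def is_arg_min_def)
  then have le: "robust_objective \<epsilon> ghat u \<le> robust_objective \<epsilon> ghat ((1 - e) *\<^sub>R u)"
    using u by (auto simp: robust_optimizer_def is_arg_min_linorder)
  have "N / 2 + c \<le> (1 - e)\<^sup>2 * N / 2 + (1 - e) * c"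
  proof -
    have "robust_objective \<epsilon> ghat ((1 - e) *\<^sub>R u) = (1 - e)\<^sup>2 * N / 2 + (1 - e) * c"
      using e by (simp add: robust_objective_def c_def N_def power_mult_distrib distrib_left)
    then show ?thesis
      using le by (simp add: robust_objective_def c_def N_def)
  qed
  then have "e * (N + c) \<le> e * (e * N / 2)"
    by (simp add: power2_eq_square algebra_simps)
  then have "N + c \<le> e * N / 2" using e by simp
  with e pos show False by simp
qed

text \<open>The slope contributes at most - t * norm u ^ 2, and the bound on t limits the quadratic
  term of the descent lemma to the fraction 1 - \<gamma>1 of that decrease.\<close>

lemma objective_decrease_small_step:
  assumes grad: "\<And>x. GDERIV (f 0) x :> g x" and lip: "L-lipschitz_on UNIV g" and L: "0 < L"
    and descent: "g x \<bullet> u \<le> - (norm u)\<^sup>2"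
    and t: "0 \<le> t" "t \<le> 2 * (1 - \<gamma>1) / L"
  shows "objective_decrease f \<gamma>1 x u t"
proof -
  have "L / 2 * t \<le> 1 - \<gamma>1" using t L by (simp add: field_simps)
  then have "L / 2 * t * (t * (norm u)\<^sup>2) \<le> (1 - \<gamma>1) * (t * (norm u)\<^sup>2)"
    using t by (intro mult_right_mono) auto
  moreover have "t * (g x \<bullet> u) \<le> t * (- (norm u)\<^sup>2)"
    using descent t by (intro mult_left_mono)
  ultimately show ?thesis
    using descent_lemma[OF grad lip t(1), of x u]
    by (simp add: objective_decrease_def power2_eq_square algebra_simps)
qed

text \<open>For t \<le> 2 * w / L the curvature term of the descent lemma is absorbed by the
  \<open>w\<close> term in the slope bound. What remains is (1 - \<alpha> * t) * f x, and \<alpha> *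
  t \<le> \<gamma>2.\<close>

lemma constraint_small_step:
  fixes f :: "'a::real_inner \<Rightarrow> real"
  assumes grad: "\<And>x. GDERIV f x :> g x" and lip: "L-lipschitz_on UNIV g" and L: "0 < L"
    and \<alpha>: "0 < \<alpha>" and fx: "f x \<le> 0"
    and slope: "g x \<bullet> u + \<alpha> * f x + w * (norm u)\<^sup>2 \<le> 0"
    and t: "0 \<le> t" "t \<le> 2 * w / L" "t \<le> \<gamma>2 / \<alpha>"
  shows "f (x + t *\<^sub>R u) \<le> (1 - \<gamma>2) * f x"
proof -
  have "L / 2 * t \<le> w" using t L by (simp add: field_simps)
  then have "L / 2 * t * (t * (norm u)\<^sup>2) \<le> w * (t * (norm u)\<^sup>2)"
    using t by (intro mult_right_mono) auto
  moreover have "t * (g x \<bullet> u + \<alpha> * f x + w * (norm u)\<^sup>2) \<le> 0"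
    using slope t by (simp add: mult_nonneg_nonpos)
  \<comment> \<open>Multiplying \<alpha> * t \<le> \<gamma>2 by the nonpositive \<open>f x\<close>
    reverses it.\<close>
  moreover have "\<gamma>2 * f x \<le> (\<alpha> * t) * f x"
    using fx \<alpha> t by (intro mult_right_mono_neg) (auto simp: field_simps)
  ultimately show ?thesis
    using descent_lemma[OF grad lip t(1), of x u]
    by (simp add: power2_eq_square algebra_simps)
qed

lemma line_search_ge:
  assumes ok: "\<And>t. 0 \<le> t \<Longrightarrow> t \<le> T \<Longrightarrow>
      objective_decrease f \<gamma>1 x u t \<and> constraint_condition m f \<gamma>2 x u t"
    and T: "0 < T" "T \<le> tinit" and \<beta>: "0 < \<beta>" "\<beta> < 1"
  shows "\<exists>tk. line_search m f \<beta> \<gamma>1 \<gamma>2 tinit x u = Some tk \<and> \<beta> * T \<le> tk"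
proof -
  let ?b = "\<lambda>t. \<not> (objective_decrease f \<gamma>1 x u t \<and> constraint_condition m f \<gamma>2 x u t)"
  have iter: "((\<lambda>t. \<beta> * t) ^^ k) tinit = \<beta> ^ k * tinit" for k
    by (induction k) auto
  \<comment> \<open>Termination: the powers of \<beta> bring the trial step down into the interval
    where \<open>ok\<close> applies.\<close>
  obtain k where "\<beta> ^ k < T / tinit"
    using real_arch_pow_inv[of "T / tinit" \<beta>] T \<beta> by auto
  then have "\<beta> ^ k * tinit \<le> T" using T by (simp add: field_simps)
  then have "\<not> ?b (((\<lambda>t. \<beta> * t) ^^ k) tinit)"
    using ok[of "\<beta> ^ k * tinit"] T \<beta> by (simp add: iter)
  then have "\<exists>k. \<not> ?b (((\<lambda>t. \<beta> * t) ^^ k) tinit)" by (rule exI)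
  then obtain tk where tk: "while_option ?b (\<lambda>t. \<beta> * t) tinit = Some tk"
    by (simp only: while_option_def if_True)
  have "\<beta> * T \<le> tk"
  \<comment> \<open>The loop invariant is \<beta> * T \<le> t. By \<open>ok\<close>, a rejected t
    lies above T, so one more reduction stays above \<beta> * T.\<close>
  proof (rule while_option_rule[OF _ tk, where P = "\<lambda>t. \<beta> * T \<le> t"])
    show "\<beta> * T \<le> tinit"
      using mult_right_mono[of \<beta> 1 T] T \<beta> by linarith
  next
    fix t assume t: "\<beta> * T \<le> t" and b: "?b t"
    have "0 \<le> t" using t T \<beta> mult_pos_pos[of \<beta> T] by linarith
    then have "T < t" using ok[of t] b by force
    then show "\<beta> * T \<le> \<beta> * t" using \<beta> by simp
  qed
  with tk show ?thesis unfolding line_search_def by blast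
qed

theorem proposition1:
  fixes m :: nat
    and f :: "nat \<Rightarrow> real ^ 'n \<Rightarrow> real"
    and grad :: "nat \<Rightarrow> real ^ 'n \<Rightarrow> real ^ 'n"
    and ghat :: "nat \<Rightarrow> real ^ 'n"
    and L \<epsilon> w :: "nat \<Rightarrow> real"
    and \<alpha> \<beta> \<gamma>1 \<gamma>2 tinit :: real
    and xk u :: "real ^ 'n"
  assumes eps_pos: "\<And>i. i \<in> {0..m} \<Longrightarrow> 0 < \<epsilon> i"
    and alpha_pos: "0 < \<alpha>"
    and w_pos: "\<And>i. i \<in> {1..m} \<Longrightarrow> 0 < w i"
    and beta: "\<beta> \<in> {0<..<1}"
    and gamma1: "\<gamma>1 \<in> {0<..<1}"
    and gamma2: "\<gamma>2 \<in> {0<..<1}"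
    and tinit_pos: "0 < tinit"
    and L_pos: "\<And>i. i \<in> {0..m} \<Longrightarrow> 0 < L i"
    and grad: "\<And>i x. i \<in> {0..m} \<Longrightarrow> GDERIV (f i) x :> grad i x"
    and grad_cont: "\<And>i. i \<in> {0..m} \<Longrightarrow> continuous_on UNIV (grad i)"
    and grad_lipschitz: "\<And>i. i \<in> {0..m} \<Longrightarrow> (L i)-lipschitz_on UNIV (grad i)"
    and optimum_attained: "\<exists>xstar. is_arg_min (f 0) (feasible m f) xstar"
    and mfcq: "mfcq m f grad"
    and xk: "strictly_feasible m f xk"
    and ghat: "\<And>i. i \<in> {0..m} \<Longrightarrow> norm (grad i xk - ghat i) \<le> \<epsilon> i"
    and u: "robust_optimizer m f \<epsilon> \<alpha> w ghat xk u"
  shows "(\<forall>t \<in> {0..t_min m L \<alpha> w \<beta> \<gamma>1 \<gamma>2 tinit}.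
            objective_decrease f \<gamma>1 xk u t \<and> constraint_condition m f \<gamma>2 xk u t) \<and>
         (\<exists>tk. line_search m f \<beta> \<gamma>1 \<gamma>2 tinit xk u = Some tk \<and>
               t_min m L \<alpha> w \<beta> \<gamma>1 \<gamma>2 tinit \<le> tk)"
proof -
  \<comment> \<open>This is \<open>t_min\<close> without its factor \<beta>, the largest step
    covered by the two small-step lemmas that does not exceed \<open>tinit\<close>.\<close>
  define T where "T = Min ({2 * (1 - \<gamma>1) / L 0} \<union> (\<lambda>i. 2 * w i / L i) ` {1..m} \<union> {\<gamma>2 / \<alpha>, tinit})"
  have tmin: "t_min m L \<alpha> w \<beta> \<gamma>1 \<gamma>2 tinit = \<beta> * T"
    by (simp add: t_min_def T_def)
  have "0 < T"
    unfolding T_def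
    using alpha_pos w_pos gamma1 gamma2 tinit_pos L_pos by (subst Min_gr_iff) auto
  have T_le: "T \<le> 2 * (1 - \<gamma>1) / L 0" "T \<le> \<gamma>2 / \<alpha>" "T \<le> tinit"
    unfolding T_def by (intro Min_le; simp)+
  have T_le_w: "T \<le> 2 * w i / L i" if "i \<in> {1..m}" for i
    unfolding T_def using that by (intro Min_le) auto
  have fx: "f i xk \<le> 0" if "i \<in> {1..m}" for i
    using xk that by (force simp: strictly_feasible_def)
  have robust: "grad i xk \<bullet> u \<le> ghat i \<bullet> u + \<epsilon> i * norm u" if "i \<in> {0..m}" for i
    using ghat[OF that] by (rule inner_le_robust_inner)
  have "ghat 0 \<bullet> u + \<epsilon> 0 * norm u \<le> - (norm u)\<^sup>2"
    using u fx alpha_pos w_pos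
    by (intro robust_optimizer_descent_direction) (auto simp: feasible_def less_imp_le)
  then have descent: "grad 0 xk \<bullet> u \<le> - (norm u)\<^sup>2"
    using robust[of 0] by simp
  \<comment> \<open>Feasibility of the optimizer, with the estimated slope and its margin replaced
    by the smaller true slope.\<close>
  have slope: "grad i xk \<bullet> u + \<alpha> * f i xk + w i * (norm u)\<^sup>2 \<le> 0" if "i \<in> {1..m}" for i
    using u that robust[of i]
    by (force simp: robust_optimizer_def is_arg_min_def robust_feasible_def)
  \<comment> \<open>Proved up to T rather than \<beta> * T: the line search may overshoot by one
    factor \<beta>, which \<open>line_search_ge\<close> accounts for.\<close>
  have ok: "objective_decrease f \<gamma>1 xk u t \<and> constraint_condition m f \<gamma>2 xk u t"
    if t: "0 \<le> t" "t \<le> T" for t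
  proof
    show "objective_decrease f \<gamma>1 xk u t"
      using t T_le descent
      by (intro objective_decrease_small_step[OF grad grad_lipschitz L_pos]) auto
    show "constraint_condition m f \<gamma>2 xk u t"
      unfolding constraint_condition_def
    proof
      fix i assume i: "i \<in> {1..m}"
      then have i0: "i \<in> {0..m}" by simp
      show "f i (xk + t *\<^sub>R u) \<le> (1 - \<gamma>2) * f i xk"
        using t T_le T_le_w[OF i]
        by (intro constraint_small_step[OF grad[OF i0] grad_lipschitz[OF i0] L_pos[OF i0]
              alpha_pos fx[OF i] slope[OF i]]) auto
    qed
  qed
  have "\<beta> * T \<le> T"
    using mult_right_mono[of \<beta> 1 T] \<open>0 < T\<close> beta by simp
  show ?thesis
    unfolding tmin
  proof (intro conjI ballI)
    show "\<exists>tk. line_search m f \<beta> \<gamma>1 \<gamma>2 tinit xk u = Some tk \<and> \<beta> * T \<le> tk"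
      using ok \<open>0 < T\<close> T_le(3) beta by (intro line_search_ge) simp_all
  next
    fix t assume "t \<in> {0..\<beta> * T}"
    with \<open>\<beta> * T \<le> T\<close> have "0 \<le> t" "t \<le> T" by auto
    from ok[OF this] show "objective_decrease f \<gamma>1 xk u t" "constraint_condition m f \<gamma>2 xk u t"
      by simp_all
  qed
qed

end
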